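(* In the setting of operator classes $L^0_{jk}$, $L^{-\infty}_{jk}$ described in the context, let $A_0\in L^0_{01}$ be elliptic and let $V_j\subset H^\infty_j$, $j=0,1$, be finite-dimensional subspaces such that $\ker A_0^s=V_0$ and $H^s_1=V_1\oplus\mathrm{im}\,A_0^s$ for every $s\in\Sigma$. Assume that $\pi_j\in L^{-\infty}_{jj}$, $j=0,1$, are projections with $\mathrm{im}\,\pi_j=V_j$. Furthermore assume that, for every $s\in\Sigma$, composition of operators induces maps $$(A,B,C)\mapsto ABC,\qquad L^{-\infty}_{00}\times\mathscr L(H^s_1,H^s_0)\times L^{-\infty}_{11}\to L^{-\infty}_{10}.$$ Then there exists a parametrix $A_1\in L^0_{10}$ of $A_0$ such that $$A_1A_0=1-\pi_0,\qquad A_0A_1=1-\pi_1.$$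
   Context: Let $\Sigma\subset\mathbb R^n$ and let $\{H^s_j\}_{s\in\Sigma}$, $j=0,1$, be two families of Banach spaces such that, for every $s\in\Sigma$ and $j=0,1$: (1) $H^\infty_j:=\bigcap_{s\in\Sigma}H^s_j$ is a dense subspace of $H^s_j$; (2) any continuous operator $T:H^s_j\to H^s_j$ with $\mathrm{im}\,T\subset H^\infty_j$ is compact. $\mathscr L(X,Y)$ denotes bounded linear operators. For $j,k\in\{0,1\}$ let $L^0_{jk}$ be a vector space of operators $H^\infty_j\to H^\infty_k$ each of which extends by continuity to an operator in $\mathscr L(H^s_j,H^s_k)$ for every $s\in\Sigma$ (the extension of $A$ is denoted $A^s$), and let $L^{-\infty}_{jk}\subset L^0_{jk}$ be a subspace of regularizing operators, i.e. operators whose extensions map $H^s_j$ into $H^\infty_k$ for every $s\in\Sigma$. Assume that for all $j,k,\ell\in\{0,1\}$ composition of operators induces maps $(A,B)\mapsto AB$, $L^s_{k\ell}\times L^t_{jk}\to L^{s+t}_{j\ell}$ for $s,t\in\{-\infty,0\}$. A parametrix of $A_0\in L^0_{01}$ is any $A_1\in L^0_{10}$ with $1-A_1A_0\in L^{-\infty}_{00}$ and $1-A_0A_1\in L^{-\infty}_{11}$; an operator possessing a parametrix is called elliptic. (For elliptic $A_0$, spaces $V_0,V_1$ as in the claim exist.) In the triple composition hypothesis, the product $ABC$ is formed by letting $C$ map $H^\infty_1\to H_1^\infty\subset H^s_1$, then $B$, then the extension $A^s$, with values in $H^\infty_0$.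
   Formalization: The formal theorem additionally assumes that π_1 vanishes on im A_0 (π_1 A_0 = 0), i.e. π_1 is the projection along im A_0; without this the claim is false (e.g. A_0(x,y)=(x,0), π_1(x,y)=(0,y-x) on R^2), and the conclusion forces it. Σ is taken nonempty. *)

theory Defs
  imports "HOL-Analysis.Analysis"
begin

text \<open>
  All spaces of the two families are subspaces of one ambient vector space \<open>'a\<close>, so that
  the intersections over \<open>s\<close> make sense; this is no restriction for the pair of families, since
  ambient spaces \<open>X\<close> and \<open>Y\<close> both embed in \<open>X \<times> Y\<close>.
  The scalars form a \<^class>\<open>real_normed_field\<close>, which by Mazur's theorem means the
  reals or the complex numbers.  The families are indexed by the two-element type
  \<^typ>\<open>2\<close> with elements \<open>0\<close> and \<open>1\<close>.

  An operator with domain \<open>D\<close> is a function that is extensional on \<open>D\<close> in the sense of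
  \<^theory>\<open>HOL-Library.FuncSet\<close>, so that equality of operators is equality of functions.
\<close>

record 'a normed_carrier =
  pts :: "'a set"
  nrm :: "'a \<Rightarrow> real"

text \<open>The value \<open>0\<close> off the carrier is irrelevant; the locale \<^locale>\<open>Metric_space\<close> wants
  non-negativity and symmetry on the whole type.\<close>

definition norm_metric :: "'a::ab_group_add normed_carrier \<Rightarrow> 'a \<Rightarrow> 'a \<Rightarrow> real" where
  "norm_metric X x y = (if x \<in> pts X \<and> y \<in> pts X then nrm X (x - y) else 0)"

definition norm_topology :: "'a::ab_group_add normed_carrier \<Rightarrow> 'a topology" where
  "norm_topology X = Metric_space.mtopology (pts X) (norm_metric X)"

definition banach_space_on ::
  "('k::real_normed_field \<Rightarrow> 'a::ab_group_add \<Rightarrow> 'a) \<Rightarrow> 'a normed_carrier \<Rightarrow> bool" where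
  "banach_space_on scl X \<longleftrightarrow>
     module.subspace scl (pts X) \<and>
     (\<forall>x\<in>pts X. 0 \<le> nrm X x \<and> (nrm X x = 0 \<longleftrightarrow> x = 0)) \<and>
     (\<forall>x\<in>pts X. \<forall>y\<in>pts X. nrm X (x + y) \<le> nrm X x + nrm X y) \<and>
     (\<forall>c. \<forall>x\<in>pts X. nrm X (scl c x) = norm c * nrm X x) \<and>
     Metric_space.mcomplete (pts X) (norm_metric X)"

definition linear_ops ::
  "('k \<Rightarrow> 'a::ab_group_add \<Rightarrow> 'a) \<Rightarrow> 'a set \<Rightarrow> 'a set \<Rightarrow> ('a \<Rightarrow> 'a) set" where
  "linear_ops scl D E =
     {T \<in> D \<rightarrow>\<^sub>E E. (\<forall>x\<in>D. \<forall>y\<in>D. T (x + y) = T x + T y) \<and>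
                  (\<forall>c. \<forall>x\<in>D. T (scl c x) = scl c (T x))}"

definition bounded_ops ::
  "('k \<Rightarrow> 'a::ab_group_add \<Rightarrow> 'a) \<Rightarrow> 'a normed_carrier \<Rightarrow> 'a normed_carrier \<Rightarrow> ('a \<Rightarrow> 'a) set"
  where
  "bounded_ops scl X Y =
     {T \<in> linear_ops scl (pts X) (pts Y). \<exists>C. \<forall>x\<in>pts X. nrm Y (T x) \<le> C * nrm X x}"

definition compact_op ::
  "'a::ab_group_add normed_carrier \<Rightarrow> 'a normed_carrier \<Rightarrow> ('a \<Rightarrow> 'a) \<Rightarrow> bool" where
  "compact_op X Y T \<longleftrightarrow>
     compactin (norm_topology Y) (norm_topology Y closure_of (T ` {x \<in> pts X. nrm X x \<le> 1}))"

definition H_inf ::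
  "(real^'n) set \<Rightarrow> (2 \<Rightarrow> real^'n \<Rightarrow> 'a normed_carrier) \<Rightarrow> 2 \<Rightarrow> 'a set" where
  "H_inf Sig H j = (\<Inter>s\<in>Sig. pts (H j s))"

text \<open>The extension by continuity of \<open>A\<close> to an operator from \<open>H j s\<close> to \<open>H k s\<close>; where it
  exists it is unique, because \<open>H_inf Sig H j\<close> is dense in \<open>H j s\<close>.\<close>

definition ext_op ::
  "('k \<Rightarrow> 'a::ab_group_add \<Rightarrow> 'a) \<Rightarrow> (real^'n) set \<Rightarrow> (2 \<Rightarrow> real^'n \<Rightarrow> 'a normed_carrier) \<Rightarrow>
   2 \<Rightarrow> 2 \<Rightarrow> real^'n \<Rightarrow> ('a \<Rightarrow> 'a) \<Rightarrow> 'a \<Rightarrow> 'a" where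
  "ext_op scl Sig H j k s A =
     (THE T. T \<in> bounded_ops scl (H j s) (H k s) \<and> (\<forall>u\<in>H_inf Sig H j. T u = A u))"

definition op_subspace ::
  "('k \<Rightarrow> 'a::ab_group_add \<Rightarrow> 'a) \<Rightarrow> 'a set \<Rightarrow> ('a \<Rightarrow> 'a) set \<Rightarrow> bool" where
  "op_subspace scl D M \<longleftrightarrow>
     (\<lambda>u\<in>D. 0) \<in> M \<and>
     (\<forall>A\<in>M. \<forall>B\<in>M. (\<lambda>u\<in>D. A u + B u) \<in> M) \<and>
     (\<forall>c. \<forall>A\<in>M. (\<lambda>u\<in>D. scl c (A u)) \<in> M)"

text \<open>\<open>L r j k\<close> is the class of operators of order \<open>r\<close> from \<open>H_inf Sig H j\<close> to \<open>H_inf Sig H k\<close>;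
  only the orders \<open>r = 0\<close> and \<open>r = -\<infinity>\<close> matter, and orders are added as extended reals.\<close>

locale operator_classes = vector_space scl
  for scl :: "'k::real_normed_field \<Rightarrow> 'a::ab_group_add \<Rightarrow> 'a" +
  fixes Sig :: "(real^'n) set"
    and H :: "2 \<Rightarrow> real^'n \<Rightarrow> 'a normed_carrier"
    and L :: "ereal \<Rightarrow> 2 \<Rightarrow> 2 \<Rightarrow> ('a \<Rightarrow> 'a) set"
  assumes Sig_nonempty: "Sig \<noteq> {}"
    and banach: "s \<in> Sig \<Longrightarrow> banach_space_on scl (H j s)"
    and dense: "s \<in> Sig \<Longrightarrow> norm_topology (H j s) closure_of H_inf Sig H j = pts (H j s)"
    and compact: "\<lbrakk>s \<in> Sig; T \<in> bounded_ops scl (H j s) (H j s); T ` pts (H j s) \<subseteq> H_inf Sig H j\<rbrakk>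
           \<Longrightarrow> compact_op (H j s) (H j s) T"
    and L0_linear: "L 0 j k \<subseteq> linear_ops scl (H_inf Sig H j) (H_inf Sig H k)"
    and L0_extends: "\<lbrakk>A \<in> L 0 j k; s \<in> Sig\<rbrakk>
           \<Longrightarrow> \<exists>T \<in> bounded_ops scl (H j s) (H k s). \<forall>u\<in>H_inf Sig H j. T u = A u"
    and L0_subspace: "op_subspace scl (H_inf Sig H j) (L 0 j k)"
    and Linf_subset: "L (-\<infinity>) j k \<subseteq> L 0 j k"
    and Linf_subspace: "op_subspace scl (H_inf Sig H j) (L (-\<infinity>) j k)"
    and Linf_regularizing: "\<lbrakk>A \<in> L (-\<infinity>) j k; s \<in> Sig\<rbrakk>
           \<Longrightarrow> ext_op scl Sig H j k s A ` pts (H j s) \<subseteq> H_inf Sig H k"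
    and L_compose: "\<lbrakk>r \<in> {-\<infinity>, 0}; t \<in> {-\<infinity>, 0}; A \<in> L r k l; B \<in> L t j k\<rbrakk>
           \<Longrightarrow> compose (H_inf Sig H j) A B \<in> L (r + t) j l"

definition parametrix ::
  "(real^'n) set \<Rightarrow> (2 \<Rightarrow> real^'n \<Rightarrow> 'a::ab_group_add normed_carrier) \<Rightarrow>
   (ereal \<Rightarrow> 2 \<Rightarrow> 2 \<Rightarrow> ('a \<Rightarrow> 'a) set) \<Rightarrow> ('a \<Rightarrow> 'a) \<Rightarrow> ('a \<Rightarrow> 'a) \<Rightarrow> bool" where
  "parametrix Sig H L A\<^sub>0 A\<^sub>1 \<longleftrightarrow>
     A\<^sub>1 \<in> L 0 1 0 \<and>
     (\<lambda>u\<in>H_inf Sig H 0. u - A\<^sub>1 (A\<^sub>0 u)) \<in> L (-\<infinity>) 0 0 \<and>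
     (\<lambda>v\<in>H_inf Sig H 1. v - A\<^sub>0 (A\<^sub>1 v)) \<in> L (-\<infinity>) 1 1"

definition elliptic ::
  "(real^'n) set \<Rightarrow> (2 \<Rightarrow> real^'n \<Rightarrow> 'a::ab_group_add normed_carrier) \<Rightarrow>
   (ereal \<Rightarrow> 2 \<Rightarrow> 2 \<Rightarrow> ('a \<Rightarrow> 'a) set) \<Rightarrow> ('a \<Rightarrow> 'a) \<Rightarrow> bool" where
  "elliptic Sig H L A\<^sub>0 \<longleftrightarrow> A\<^sub>0 \<in> L 0 0 1 \<and> (\<exists>A\<^sub>1. parametrix Sig H L A\<^sub>0 A\<^sub>1)"

definition finite_dim_subspace :: "('k::field \<Rightarrow> 'a::ab_group_add \<Rightarrow> 'a) \<Rightarrow> 'a set \<Rightarrow> bool" where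
  "finite_dim_subspace scl V \<longleftrightarrow> (\<exists>B. finite B \<and> module.span scl B = V)"

definition is_direct_sum :: "'a::ab_group_add set \<Rightarrow> 'a set \<Rightarrow> 'a set \<Rightarrow> bool" where
  "is_direct_sum X V W \<longleftrightarrow> X = {v + w | v w. v \<in> V \<and> w \<in> W} \<and> V \<inter> W = {0}"

definition regularizing_projection ::
  "(real^'n) set \<Rightarrow> (2 \<Rightarrow> real^'n \<Rightarrow> 'a normed_carrier) \<Rightarrow>
   (ereal \<Rightarrow> 2 \<Rightarrow> 2 \<Rightarrow> ('a \<Rightarrow> 'a) set) \<Rightarrow> 2 \<Rightarrow> 'a set \<Rightarrow> ('a \<Rightarrow> 'a) \<Rightarrow> bool" where
  "regularizing_projection Sig H L j V P \<longleftrightarrow>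
     P \<in> L (-\<infinity>) j j \<and> (\<forall>u\<in>H_inf Sig H j. P (P u) = P u) \<and> P ` H_inf Sig H j = V"

end

theory Submission
  imports Defs
begin

text \<open>
  Fix one \<open>s\<close>.  On the spaces of index \<open>s\<close> the inverse that is looked for exists already by
  algebra: as \<open>\<pi>\<^sub>0\<close> projects onto the kernel of \<open>A\<^sub>0\<close> and \<open>\<pi>\<^sub>1\<close> projects along its range
  onto a complement, sending \<open>y\<close> to the unique solution \<open>x\<close> of \<open>A\<^sub>0 x = y - \<pi>\<^sub>1 y\<close>,
  \<open>\<pi>\<^sub>0 x = 0\<close> defines an operator \<open>G\<close> with \<open>A\<^sub>0 G = 1 - \<pi>\<^sub>1\<close> and \<open>G A\<^sub>0 = 1 - \<pi>\<^sub>0\<close>.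
  What has to be shown is that \<open>G\<close> restricts to an operator of the class \<open>L 0 1 0\<close>.

  Let \<open>B\<close> be any parametrix, with regularizing errors \<open>R0 = 1 - B A\<^sub>0\<close> and
  \<open>R1 = 1 - A\<^sub>0 B\<close>.  Multiplying \<open>A\<^sub>0 G = 1 - \<pi>\<^sub>1\<close> by \<open>B\<close> from the left and
  \<open>G A\<^sub>0 = 1 - \<pi>\<^sub>0\<close> by \<open>B\<close> from the right gives
  \<open>G = B - B \<pi>\<^sub>1 + R0 G\<close> and \<open>G = B - \<pi>\<^sub>0 B + G R1\<close>; inserting the second into the first,
  \<open>G = B - B \<pi>\<^sub>1 + R0 B - R0 \<pi>\<^sub>0 B + R0 G R1\<close>.
  All terms but the last are compositions of operators in the classes.  The last one
  is regularizing by the hypothesis on triple products, as soon as \<open>G\<close> is bounded.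

  Boundedness of \<open>G\<close> (\<open>bounded_inverse_modulo_projections\<close>) rests on the a priori estimate
  \<open>estimate_modulo_compact\<close>: since \<open>x = B (A\<^sub>0 x) + R0 x\<close> and the regularizing operator
  \<open>R0\<close> is compact on the space of index \<open>s\<close>, the norm of \<open>x\<close> is bounded by a multiple of the
  norm of \<open>A\<^sub>0 x\<close> on the complement of the kernel where \<open>\<pi>\<^sub>0 x = 0\<close>.
\<close>

section \<open>Bounded operators between carrier-based normed spaces\<close>

text \<open>A \<^locale>\<open>vector_space\<close> may have scalars without an absolute value, over which a
  homogeneous norm makes no sense.\<close>

locale normed_field_vector_space = vector_space scl
  for scl :: "'k::real_normed_field \<Rightarrow> 'a::ab_group_add \<Rightarrow> 'a"
begin

lemma banach_space_onD:
  assumes "banach_space_on scl X"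
  shows banach_subspace: "subspace (pts X)"
    and nrm_nonneg: "x \<in> pts X \<Longrightarrow> 0 \<le> nrm X x"
    and nrm_eq_0_iff: "x \<in> pts X \<Longrightarrow> nrm X x = 0 \<longleftrightarrow> x = 0"
    and nrm_triangle: "\<lbrakk>x \<in> pts X; y \<in> pts X\<rbrakk> \<Longrightarrow> nrm X (x + y) \<le> nrm X x + nrm X y"
    and nrm_scale: "x \<in> pts X \<Longrightarrow> nrm X (scl c x) = norm c * nrm X x"
  using assms unfolding banach_space_on_def by blast+

lemma nrm_minus_commute:
  assumes X: "banach_space_on scl X" and "x \<in> pts X" "y \<in> pts X"
  shows "nrm X (x - y) = nrm X (y - x)"
proof -
  have "y - x \<in> pts X"
    using assms(2,3) by (intro subspace_diff banach_subspace[OF X])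
  from nrm_scale[OF X this, of "-1"] show ?thesis by simp
qed

lemma nrm_diff_triangle:
  assumes X: "banach_space_on scl X" and "x \<in> pts X" "y \<in> pts X"
  shows "nrm X (x - y) \<le> nrm X x + nrm X y"
proof -
  have "nrm X (scl (-1) y) = nrm X y"
    using nrm_scale[OF X assms(3), of "-1"] by simp
  moreover have "scl (-1) y \<in> pts X"
    using assms(3) by (intro subspace_scale banach_subspace[OF X])
  ultimately show ?thesis
    using nrm_triangle[OF X assms(2), of "scl (-1) y"] by simp
qed

lemma Metric_space_norm_metric:
  assumes X: "banach_space_on scl X"
  shows "Metric_space (pts X) (norm_metric X)"
proof
  note sub = subspace_diff[OF banach_subspace[OF X]]
  show "0 \<le> norm_metric X x y" for x y
    using nrm_nonneg[OF X sub] by (simp add: norm_metric_def)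
  show "norm_metric X x y = norm_metric X y x" for x y
    using nrm_minus_commute[OF X] by (simp add: norm_metric_def)
  show "norm_metric X x y = 0 \<longleftrightarrow> x = y" if "x \<in> pts X" "y \<in> pts X" for x y
    using that nrm_eq_0_iff[OF X sub] by (simp add: norm_metric_def)
  show "norm_metric X x z \<le> norm_metric X x y + norm_metric X y z"
    if "x \<in> pts X" "y \<in> pts X" "z \<in> pts X" for x y z
    using that nrm_triangle[OF X sub sub, of x y y z] by (simp add: norm_metric_def)
qed

lemma dense_approx:
  assumes X: "banach_space_on scl X" and D: "norm_topology X closure_of D = pts X"
    and "x \<in> pts X" "0 < e"
  obtains u where "u \<in> D" "u \<in> pts X" "nrm X (x - u) < e"
proof -
  interpret Metric_space "pts X" "norm_metric X"
    by (rule Metric_space_norm_metric[OF X])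
  have "x \<in> mtopology closure_of D"
    using assms(3) D by (simp add: norm_topology_def)
  then obtain u where "u \<in> D" "u \<in> mball x e"
    using \<open>0 < e\<close> unfolding metric_closure_of by blast
  with that show thesis by (auto simp: norm_metric_def in_mball)
qed

lemma compact_op_subsequence:
  assumes X: "banach_space_on scl X" and Y: "banach_space_on scl Y"
    and T: "compact_op X Y T" "T \<in> pts X \<rightarrow> pts Y"
    and x: "\<And>n. x n \<in> pts X" "\<And>n. nrm X (x n) \<le> 1"
  obtains l r where "l \<in> pts Y" "strict_mono (r :: nat \<Rightarrow> nat)"
    "(\<lambda>n. nrm Y (T (x (r n)) - l)) \<longlonglongrightarrow> 0"
proof -
  interpret Metric_space "pts Y" "norm_metric Y"
    by (rule Metric_space_norm_metric[OF Y])
  let ?B = "T ` {x \<in> pts X. nrm X x \<le> 1}"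
  have "?B \<subseteq> pts Y" using T(2) by blast
  then have "?B \<subseteq> mtopology closure_of ?B"
    by (intro closure_of_subset) simp
  moreover have "range (\<lambda>n. T (x n)) \<subseteq> ?B" using x by auto
  ultimately have "range (\<lambda>n. T (x n)) \<subseteq> mtopology closure_of ?B" by (rule order_trans[rotated])
  then obtain l r where "strict_mono (r :: nat \<Rightarrow> nat)"
      "limitin mtopology ((\<lambda>n. T (x n)) \<circ> r) l sequentially"
    using T(1) unfolding compact_op_def norm_topology_def compactin_sequentially by meson
  moreover from this have "l \<in> pts Y" "(\<lambda>n. norm_metric Y (T (x (r n))) l) \<longlonglongrightarrow> 0"
    by (auto simp: limitin_metric_dist_null)
  moreover from this have "(\<lambda>n. nrm Y (T (x (r n)) - l)) \<longlonglongrightarrow> 0"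
    using T(2) x(1) by (simp add: norm_metric_def Pi_iff)
  ultimately show thesis using that by blast
qed

lemma linear_opsD:
  assumes "T \<in> linear_ops scl D E"
  shows linear_ops_in: "x \<in> D \<Longrightarrow> T x \<in> E"
    and linear_ops_extensional: "T \<in> extensional D"
    and linear_ops_add: "\<lbrakk>x \<in> D; y \<in> D\<rbrakk> \<Longrightarrow> T (x + y) = T x + T y"
    and linear_ops_scale: "x \<in> D \<Longrightarrow> T (scl c x) = scl c (T x)"
  using assms by (auto simp: linear_ops_def PiE_def)

lemma linear_ops_diff:
  assumes T: "T \<in> linear_ops scl D E" and D: "subspace D" and "x \<in> D" "y \<in> D"
  shows "T (x - y) = T x - T y"
  using linear_ops_add[OF T \<open>x \<in> D\<close> subspace_scale[OF D \<open>y \<in> D\<close>], of "-1"]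
    linear_ops_scale[OF T \<open>y \<in> D\<close>, of "-1"]
  by simp

lemma bounded_ops_linear: "T \<in> bounded_ops scl X Y \<Longrightarrow> T \<in> linear_ops scl (pts X) (pts Y)"
  by (simp add: bounded_ops_def)

lemmas bounded_ops_in = linear_ops_in[OF bounded_ops_linear]
  and bounded_ops_add = linear_ops_add[OF bounded_ops_linear]
  and bounded_ops_scale = linear_ops_scale[OF bounded_ops_linear]
  and bounded_ops_diff = linear_ops_diff[OF bounded_ops_linear]

lemma bounded_opsE:
  assumes X: "banach_space_on scl X" and T: "T \<in> bounded_ops scl X Y"
  obtains C where "0 \<le> C" "\<And>x. x \<in> pts X \<Longrightarrow> nrm Y (T x) \<le> C * nrm X x"
proof -
  obtain C where C: "\<forall>x\<in>pts X. nrm Y (T x) \<le> C * nrm X x"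
    using T unfolding bounded_ops_def by blast
  have "nrm Y (T x) \<le> max C 0 * nrm X x" if "x \<in> pts X" for x
    using C that mult_right_mono[OF max.cobounded1[of C 0] nrm_nonneg[OF X that]] by fastforce
  then show thesis by (intro that[of "max C 0"]) auto
qed

lemma identity_bounded:
  assumes X: "banach_space_on scl X"
  shows "(\<lambda>x\<in>pts X. x) \<in> bounded_ops scl X X"
  using subspace_add[OF banach_subspace[OF X]] subspace_scale[OF banach_subspace[OF X]]
  by (auto simp: bounded_ops_def linear_ops_def intro!: exI[of _ 1])

lemma difference_bounded:
  assumes X: "banach_space_on scl X" and Y: "banach_space_on scl Y"
    and S: "S \<in> bounded_ops scl X Y" and T: "T \<in> bounded_ops scl X Y"
  shows "(\<lambda>x\<in>pts X. S x - T x) \<in> bounded_ops scl X Y"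
proof -
  note subX = banach_subspace[OF X] and subY = banach_subspace[OF Y]
  obtain C D where C: "\<And>x. x \<in> pts X \<Longrightarrow> nrm Y (S x) \<le> C * nrm X x"
    and D: "\<And>x. x \<in> pts X \<Longrightarrow> nrm Y (T x) \<le> D * nrm X x"
    using bounded_opsE[OF X S] bounded_opsE[OF X T] by metis
  have "nrm Y (S x - T x) \<le> (C + D) * nrm X x" if "x \<in> pts X" for x
    using nrm_diff_triangle[OF Y bounded_ops_in[OF S that] bounded_ops_in[OF T that]]
      C[OF that] D[OF that] by (simp add: distrib_right)
  then show ?thesis
    using subspace_add[OF subX] subspace_scale[OF subX]
      subspace_diff[OF subY bounded_ops_in[OF S] bounded_ops_in[OF T]]
    by (auto simp: bounded_ops_def linear_ops_def scale_right_diff_distrib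
        bounded_ops_add[OF S] bounded_ops_add[OF T] bounded_ops_scale[OF S] bounded_ops_scale[OF T])
qed

lemma compose_bounded:
  assumes X: "banach_space_on scl X" and Y: "banach_space_on scl Y"
    and S: "S \<in> bounded_ops scl Y Z" and T: "T \<in> bounded_ops scl X Y"
  shows "compose (pts X) S T \<in> bounded_ops scl X Z"
proof -
  note subX = banach_subspace[OF X]
  obtain C where C: "0 \<le> C" "\<And>y. y \<in> pts Y \<Longrightarrow> nrm Z (S y) \<le> C * nrm Y y"
    by (rule bounded_opsE[OF Y S]) blast
  obtain D where D: "\<And>x. x \<in> pts X \<Longrightarrow> nrm Y (T x) \<le> D * nrm X x"
    by (rule bounded_opsE[OF X T]) blast
  have "nrm Z (S (T x)) \<le> (C * D) * nrm X x" if "x \<in> pts X" for x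
    using order_trans[OF C(2)[OF bounded_ops_in[OF T that]] mult_left_mono[OF D[OF that] C(1)]]
    by (simp add: mult.assoc)
  then show ?thesis
    using subspace_add[OF subX] subspace_scale[OF subX]
    by (auto simp: bounded_ops_def linear_ops_def compose_def
        bounded_ops_add[OF S] bounded_ops_add[OF T] bounded_ops_scale[OF S] bounded_ops_scale[OF T]
        bounded_ops_in[OF S] bounded_ops_in[OF T])
qed

text \<open>The difference \<open>R\<close> vanishes on \<open>D\<close>, so \<open>R x = R (x - u)\<close> for the elements \<open>u\<close> of \<open>D\<close>,
  which come arbitrarily close to \<open>x\<close>.\<close>

lemma bounded_ops_eq_on_dense:
  assumes X: "banach_space_on scl X" and Y: "banach_space_on scl Y"
    and S: "S \<in> bounded_ops scl X Y" and T: "T \<in> bounded_ops scl X Y"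
    and D: "norm_topology X closure_of D = pts X" "\<And>u. u \<in> D \<Longrightarrow> S u = T u"
    and x: "x \<in> pts X"
  shows "S x = T x"
proof -
  define R where "R = (\<lambda>x\<in>pts X. S x - T x)"
  have R: "R \<in> bounded_ops scl X Y"
    unfolding R_def by (rule difference_bounded[OF X Y S T])
  obtain C where C: "0 \<le> C" "\<And>x. x \<in> pts X \<Longrightarrow> nrm Y (R x) \<le> C * nrm X x"
    by (rule bounded_opsE[OF X R]) blast
  have "nrm Y (R x) \<le> 0 + e" if "0 < e" for e
  proof -
    \<comment> \<open>\<open>C\<close> may be \<open>0\<close>, hence \<open>C + 1\<close> in the denominator.\<close>
    have "0 < e / (C + 1)" using that C(1) by simp
    from dense_approx[OF X D(1) x this] obtain u
      where u: "u \<in> D" "u \<in> pts X" "nrm X (x - u) < e / (C + 1)" .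
    have xu: "x - u \<in> pts X" using x u(2) by (intro subspace_diff banach_subspace[OF X])
    have "R u = 0" using u D(2) by (simp add: R_def)
    then have "R x = R (x - u)"
      using bounded_ops_diff[OF R banach_subspace[OF X] x u(2)] by simp
    also have "nrm Y \<dots> \<le> C * nrm X (x - u)" by (rule C(2)[OF xu])
    also have "\<dots> \<le> (C + 1) * (e / (C + 1))"
      using C(1) u(3) nrm_nonneg[OF X xu] by (intro mult_mono) auto
    also have "\<dots> = e" using C(1) by simp
    finally show ?thesis by simp
  qed
  then have "nrm Y (R x) \<le> 0" by (rule field_le_epsilon)
  then have "R x = 0"
    using nrm_nonneg[OF Y bounded_ops_in[OF R x]] nrm_eq_0_iff[OF Y bounded_ops_in[OF R x]] by simp
  then show ?thesis using x by (simp add: R_def)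
qed

lemma bounded_ops_null_sequence:
  assumes X: "banach_space_on scl X" and Y: "banach_space_on scl Y"
    and T: "T \<in> bounded_ops scl X Y" and x: "\<And>n. x n \<in> pts X"
    and lim: "(\<lambda>n. nrm X (x n)) \<longlonglongrightarrow> 0"
  shows "(\<lambda>n. nrm Y (T (x n))) \<longlonglongrightarrow> 0"
proof -
  obtain C where C: "\<And>x. x \<in> pts X \<Longrightarrow> nrm Y (T x) \<le> C * nrm X x"
    by (rule bounded_opsE[OF X T]) blast
  have bound: "(\<lambda>n. C * nrm X (x n)) \<longlonglongrightarrow> 0"
    using tendsto_mult_left[OF lim, of C] by simp
  show ?thesis
    by (rule tendsto_sandwich[OF _ _ tendsto_const bound])
      (auto simp: C x intro!: always_eventually nrm_nonneg[OF Y] bounded_ops_in[OF T])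
qed

section \<open>The inverse of an operator modulo its kernel and a complement of its range\<close>

text \<open>
  If no constant worked, there would be unit vectors \<open>x n\<close> with \<open>P (x n) = 0\<close> and
  \<open>T (x n)\<close> tending to \<open>0\<close>.  In \<open>x n = S (T (x n)) + K (x n)\<close> the first summand tends
  to \<open>0\<close>, and along a subsequence the second converges because \<open>K\<close> is compact.  So the
  subsequence itself converges; its limit is killed by \<open>T\<close> and by \<open>P\<close> and is therefore \<open>0\<close>,
  which contradicts \<open>nrm X (x n) = 1\<close>.
\<close>

lemma estimate_modulo_compact:
  fixes T S K P :: "'a \<Rightarrow> 'a"
  assumes X: "banach_space_on scl X" and Y: "banach_space_on scl Y"
    and T: "T \<in> bounded_ops scl X Y" and S: "S \<in> bounded_ops scl Y X"
    and K: "K \<in> bounded_ops scl X X" "compact_op X X K"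
    and STK: "\<And>x. x \<in> pts X \<Longrightarrow> x = S (T x) + K x"
    and P: "P \<in> bounded_ops scl X X"
    and inj: "\<And>x. \<lbrakk>x \<in> pts X; T x = 0; P x = 0\<rbrakk> \<Longrightarrow> x = 0"
  shows "\<exists>C\<ge>0. \<forall>x\<in>pts X. P x = 0 \<longrightarrow> nrm X x \<le> C * nrm Y (T x)"
proof -
  note subX = banach_subspace[OF X]
  have "\<exists>N::nat. \<forall>x\<in>pts X. P x = 0 \<longrightarrow> nrm X x \<le> real (Suc N) * nrm Y (T x)"
  proof (rule ccontr)
    assume "\<not> ?thesis"
    then have "\<forall>n::nat. \<exists>z. z \<in> pts X \<and> P z = 0 \<and> real (Suc n) * nrm Y (T z) < nrm X z"
      by (meson not_le)
    then obtain z where z: "\<And>n::nat. z n \<in> pts X" "\<And>n. P (z n) = 0"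
        "\<And>n. real (Suc n) * nrm Y (T (z n)) < nrm X (z n)"
      by metis
    have pos: "0 < nrm X (z n)" for n
      using z(3)[of n] nrm_nonneg[OF Y bounded_ops_in[OF T z(1)], of n]
      by (meson le_less_trans mult_nonneg_nonneg of_nat_0_le_iff)
    \<comment> \<open>Real factors reach the scalar field through \<^const>\<open>of_real\<close>.\<close>
    define x where "x n = scl (of_real (inverse (nrm X (z n)))) (z n)" for n
    have x: "x n \<in> pts X" for n
      unfolding x_def using z(1) by (intro subspace_scale subX)
    have norm_x: "nrm X (x n) = 1" for n
      using pos[of n] by (simp add: x_def nrm_scale[OF X z(1)] del: of_real_inverse)
    have Px: "P (x n) = 0" for n
      by (simp add: x_def bounded_ops_scale[OF P z(1)] z(2))
    have Tx: "nrm Y (T (x n)) \<le> 1 / real (Suc n)" for n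
    proof -
      have "nrm Y (T (x n)) = nrm Y (T (z n)) / nrm X (z n)"
        using pos[of n]
        by (simp add: x_def bounded_ops_scale[OF T z(1)] nrm_scale[OF Y bounded_ops_in[OF T z(1)]]
            divide_inverse del: of_real_inverse)
      also have "\<dots> \<le> 1 / real (Suc n)"
        using z(3)[of n] pos[of n] by (simp add: field_simps)
      finally show ?thesis .
    qed
    have Tx0: "(\<lambda>n. nrm Y (T (x n))) \<longlonglongrightarrow> 0"
      by (rule tendsto_sandwich[OF _ _ tendsto_const lim_inverse_n'[THEN LIMSEQ_Suc]])
        (auto simp: Tx intro!: always_eventually nrm_nonneg[OF Y] bounded_ops_in[OF T] x simp del: of_nat_Suc)
    obtain l r where l: "l \<in> pts X" and r: "strict_mono (r :: nat \<Rightarrow> nat)"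
      and Kl: "(\<lambda>n. nrm X (K (x (r n)) - l)) \<longlonglongrightarrow> 0"
      by (rule compact_op_subsequence[OF X X K(2), of x]) (auto simp: norm_x bounded_ops_in[OF K(1)] x)
    have Txr: "(\<lambda>n. nrm Y (T (x (r n)))) \<longlonglongrightarrow> 0"
      using LIMSEQ_subseq_LIMSEQ[OF Tx0 r] by (simp add: o_def)
    have xl: "x (r n) - l \<in> pts X" for n
      using x l by (intro subspace_diff subX)
    have xr: "(\<lambda>n. nrm X (x (r n) - l)) \<longlonglongrightarrow> 0"
    proof (rule tendsto_sandwich[OF _ _ tendsto_const])
      have "(\<lambda>n. nrm X (S (T (x (r n))))) \<longlonglongrightarrow> 0"
        by (rule bounded_ops_null_sequence[OF Y X S _ Txr]) (rule bounded_ops_in[OF T x])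
      from tendsto_add[OF this Kl]
      show "(\<lambda>n. nrm X (S (T (x (r n)))) + nrm X (K (x (r n)) - l)) \<longlonglongrightarrow> 0" by simp
      have "nrm X (x (r n) - l) \<le> nrm X (S (T (x (r n)))) + nrm X (K (x (r n)) - l)" for n
      proof -
        have eq: "x (r n) - l = S (T (x (r n))) + (K (x (r n)) - l)"
          using STK[OF x[of "r n"]] by (metis add_diff_eq)
        show ?thesis
          unfolding eq
          by (intro nrm_triangle[OF X] bounded_ops_in[OF S] bounded_ops_in[OF T]
              subspace_diff[OF subX] bounded_ops_in[OF K(1)] x l)
      qed
      then show "\<forall>\<^sub>F n in sequentially. nrm X (x (r n) - l)
          \<le> nrm X (S (T (x (r n)))) + nrm X (K (x (r n)) - l)" by simp
    qed (simp add: nrm_nonneg[OF X xl])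
    have vanish: "F l = 0"
      if F: "F \<in> bounded_ops scl X Z" and Z: "banach_space_on scl Z"
        and lim: "(\<lambda>n. nrm Z (F (x (r n)))) \<longlonglongrightarrow> 0" for F Z
    proof -
      have "(\<lambda>n. nrm Z (F (x (r n))) + nrm Z (F (x (r n) - l))) \<longlonglongrightarrow> 0 + 0"
        by (intro tendsto_add lim bounded_ops_null_sequence[OF X Z F _ xr] xl)
      moreover have "nrm Z (F l) \<le> nrm Z (F (x (r n))) + nrm Z (F (x (r n) - l))" for n
        using nrm_diff_triangle[OF Z bounded_ops_in[OF F x[of "r n"]] bounded_ops_in[OF F xl[of n]]]
          bounded_ops_diff[OF F subX x[of "r n"] l] by simp
      ultimately have "nrm Z (F l) \<le> 0 + 0"
        by (intro LIMSEQ_le_const) auto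
      then show ?thesis
        using nrm_nonneg[OF Z bounded_ops_in[OF F l]] nrm_eq_0_iff[OF Z bounded_ops_in[OF F l]]
        by simp
    qed
    have "nrm X (P (x (r n))) = 0" for n
      using Px nrm_eq_0_iff[OF X subspace_0[OF subX]] by simp
    then have "P l = 0" by (intro vanish[OF P X]) simp
    then have "l = 0" using inj[OF l vanish[OF T Y Txr]] by simp
    then show False using xr norm_x LIMSEQ_unique[OF tendsto_const[of "1::real"]] by fastforce
  qed
  then obtain N :: nat where "\<forall>x\<in>pts X. P x = 0 \<longrightarrow> nrm X x \<le> real (Suc N) * nrm Y (T x)" ..
  then show ?thesis by (intro exI[of _ "real (Suc N)"]) simp
qed

text \<open>
  \<open>G y\<close> is the solution \<open>x\<close> of \<open>T x = y - Q y\<close> normalized by \<open>P x = 0\<close>.  It exists because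
  \<open>x\<close> can be replaced by \<open>x - P x\<close> without changing \<open>T x\<close>, and it is unique because \<open>P\<close> is
  the identity on the kernel of \<open>T\<close>; uniqueness makes \<open>G\<close> linear and yields \<open>G (T x) = x - P x\<close>.
  Boundedness is the estimate above, applied to \<open>G y\<close>.
\<close>

lemma bounded_inverse_modulo_projections:
  fixes T S K P Q :: "'a \<Rightarrow> 'a"
  assumes X: "banach_space_on scl X" and Y: "banach_space_on scl Y"
    and T: "T \<in> bounded_ops scl X Y" and S: "S \<in> bounded_ops scl Y X"
    and K: "K \<in> bounded_ops scl X X" "compact_op X X K"
    and STK: "\<And>x. x \<in> pts X \<Longrightarrow> x = S (T x) + K x"
    and P: "P \<in> bounded_ops scl X X"
    and P_ker: "\<And>x. x \<in> pts X \<Longrightarrow> T (P x) = 0"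
    and P_id: "\<And>x. \<lbrakk>x \<in> pts X; T x = 0\<rbrakk> \<Longrightarrow> P x = x"
    and Q: "Q \<in> bounded_ops scl Y Y"
    and Q_range: "\<And>x. x \<in> pts X \<Longrightarrow> Q (T x) = 0"
    and Q_compl: "\<And>y. y \<in> pts Y \<Longrightarrow> y - Q y \<in> T ` pts X"
  shows "\<exists>G\<in>bounded_ops scl Y X.
    (\<forall>y\<in>pts Y. T (G y) = y - Q y) \<and> (\<forall>x\<in>pts X. G (T x) = x - P x)"
proof -
  note subX = banach_subspace[OF X] and subY = banach_subspace[OF Y]
  have inj: "x = 0" if "x \<in> pts X" "T x = 0" "P x = 0" for x
    using P_id[OF that(1,2)] that(3) by simp
  have uniq: "x = x'" if "x \<in> pts X" "x' \<in> pts X" "T x = T x'" "P x = 0" "P x' = 0" for x x'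
    using inj[OF subspace_diff[OF subX that(1,2)]] that(3-5)
      bounded_ops_diff[OF T subX that(1,2)] bounded_ops_diff[OF P subX that(1,2)] by simp
  have normalized: "x - P x \<in> pts X" "P (x - P x) = 0" "T (x - P x) = T x" if x: "x \<in> pts X" for x
    using bounded_ops_in[OF P x] P_ker[OF x] P_id[OF bounded_ops_in[OF P x]]
      bounded_ops_diff[OF T subX x] bounded_ops_diff[OF P subX x] subspace_diff[OF subX x] by simp_all
  have "\<exists>x. x \<in> pts X \<and> P x = 0 \<and> T x = y - Q y" if y: "y \<in> pts Y" for y
    using Q_compl[OF y] normalized by (metis imageE)
  then obtain G0 where G0: "\<And>y. y \<in> pts Y \<Longrightarrow> G0 y \<in> pts X \<and> P (G0 y) = 0 \<and> T (G0 y) = y - Q y"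
    by metis
  define G where "G = restrict G0 (pts Y)"
  have G: "G y \<in> pts X" "P (G y) = 0" "T (G y) = y - Q y" if "y \<in> pts Y" for y
    using G0 that by (auto simp: G_def)
  have linear: "G \<in> linear_ops scl (pts Y) (pts X)"
    unfolding linear_ops_def
  proof (intro CollectI conjI ballI allI)
    show "G \<in> pts Y \<rightarrow>\<^sub>E pts X" using G0 by (auto simp: G_def)
    show "G (y + y') = G y + G y'" if y: "y \<in> pts Y" and y': "y' \<in> pts Y" for y y'
    proof (rule uniq)
      show "T (G (y + y')) = T (G y + G y')"
        using y y' G subspace_add[OF subY y y']
        by (simp add: bounded_ops_add[OF T] bounded_ops_add[OF Q])
      show "P (G y + G y') = 0" using y y' G by (simp add: bounded_ops_add[OF P])
    qed (use G y y' subspace_add[OF subY y y'] in \<open>auto intro: subspace_add[OF subX]\<close>)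
    show "G (scl c y) = scl c (G y)" if y: "y \<in> pts Y" for c y
    proof (rule uniq)
      show "T (G (scl c y)) = T (scl c (G y))"
        using y G subspace_scale[OF subY y]
        by (simp add: bounded_ops_scale[OF T] bounded_ops_scale[OF Q] scale_right_diff_distrib)
      show "P (scl c (G y)) = 0" using y G by (simp add: bounded_ops_scale[OF P])
    qed (use G y subspace_scale[OF subY y] in \<open>auto intro: subspace_scale[OF subX]\<close>)
  qed
  have "\<exists>C\<ge>0. \<forall>x\<in>pts X. P x = 0 \<longrightarrow> nrm X x \<le> C * nrm Y (T x)"
    by (rule estimate_modulo_compact[OF X Y T S K _ P]) (fact STK inj)+
  then obtain C where C: "0 \<le> C" "\<forall>x\<in>pts X. P x = 0 \<longrightarrow> nrm X x \<le> C * nrm Y (T x)"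
    by blast
  obtain D where D: "\<And>y. y \<in> pts Y \<Longrightarrow> nrm Y (Q y) \<le> D * nrm Y y"
    by (rule bounded_opsE[OF Y Q]) blast
  have "nrm X (G y) \<le> (C * (1 + D)) * nrm Y y" if y: "y \<in> pts Y" for y
  proof -
    have "nrm X (G y) \<le> C * nrm Y (y - Q y)" using C(2) G[OF y] by metis
    also have "\<dots> \<le> C * ((1 + D) * nrm Y y)"
      using nrm_diff_triangle[OF Y y bounded_ops_in[OF Q y]] D[OF y]
      by (intro mult_left_mono[OF _ C(1)]) (simp add: distrib_right)
    finally show ?thesis by (simp add: mult.assoc)
  qed
  then have "G \<in> bounded_ops scl Y X" using linear by (auto simp: bounded_ops_def)
  moreover have "G (T x) = x - P x" if x: "x \<in> pts X" for x
  proof (rule uniq)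
    show "T (G (T x)) = T (x - P x)"
      using G(3)[OF bounded_ops_in[OF T x]] normalized(3)[OF x] Q_range[OF x] by simp
  qed (use G[OF bounded_ops_in[OF T x]] normalized[OF x] in auto)
  ultimately show ?thesis using G(3) by blast
qed

end

section \<open>Operator classes and their extensions\<close>

sublocale operator_classes \<subseteq> normed_field_vector_space scl ..

context operator_classes
begin

lemma H_inf_subset: "s \<in> Sig \<Longrightarrow> H_inf Sig H j \<subseteq> pts (H j s)"
  by (auto simp: H_inf_def)

lemma H_inf_subspace: "subspace (H_inf Sig H j)"
  unfolding H_inf_def
  by (intro subspace_Int banach_subspace banach)

lemma ext_eq_on_H_inf:
  assumes s: "s \<in> Sig" and S: "S \<in> bounded_ops scl (H j s) (H k s)"
    and T: "T \<in> bounded_ops scl (H j s) (H k s)"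
    and "\<And>u. u \<in> H_inf Sig H j \<Longrightarrow> S u = T u" and "x \<in> pts (H j s)"
  shows "S x = T x"
  by (rule bounded_ops_eq_on_dense[OF banach[OF s] banach[OF s] S T dense[OF s] assms(4,5)])

text \<open>The description of \<^const>\<open>ext_op\<close> is proper: an extension exists for operators of
  order \<open>0\<close>, and density leaves no choice.\<close>

lemma ext_op_props:
  assumes A: "A \<in> L 0 j k" and s: "s \<in> Sig"
  shows ext_bounded: "ext_op scl Sig H j k s A \<in> bounded_ops scl (H j s) (H k s)"
    and ext_agrees: "u \<in> H_inf Sig H j \<Longrightarrow> ext_op scl Sig H j k s A u = A u"
proof -
  have "\<exists>!T. T \<in> bounded_ops scl (H j s) (H k s) \<and> (\<forall>u\<in>H_inf Sig H j. T u = A u)"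
  proof (rule ex_ex1I)
    show "\<exists>T. T \<in> bounded_ops scl (H j s) (H k s) \<and> (\<forall>u\<in>H_inf Sig H j. T u = A u)"
      using L0_extends[OF A s] by blast
    show "T = T'" if "T \<in> bounded_ops scl (H j s) (H k s) \<and> (\<forall>u\<in>H_inf Sig H j. T u = A u)"
      "T' \<in> bounded_ops scl (H j s) (H k s) \<and> (\<forall>u\<in>H_inf Sig H j. T' u = A u)" for T T'
      using that ext_eq_on_H_inf[OF s, of T j k T']
      by (intro extensionalityI[of _ "pts (H j s)"])
        (auto intro: linear_ops_extensional bounded_ops_linear)
  qed
  from theI'[OF this]
  show "ext_op scl Sig H j k s A \<in> bounded_ops scl (H j s) (H k s)"
    and "u \<in> H_inf Sig H j \<Longrightarrow> ext_op scl Sig H j k s A u = A u"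
    by (auto simp: ext_op_def)
qed

lemma L_add:
  assumes "A \<in> L 0 j k" "B \<in> L 0 j k"
  shows "(\<lambda>u\<in>H_inf Sig H j. A u + B u) \<in> L 0 j k"
  using L0_subspace[of j k] assms unfolding op_subspace_def by blast

lemma L_diff:
  assumes "A \<in> L 0 j k" "B \<in> L 0 j k"
  shows "(\<lambda>u\<in>H_inf Sig H j. A u - B u) \<in> L 0 j k"
proof -
  have "(\<lambda>u\<in>H_inf Sig H j. scl (-1) (B u)) \<in> L 0 j k"
    using L0_subspace[of j k] assms(2) unfolding op_subspace_def by blast
  from L_add[OF assms(1) this] show ?thesis
    by (simp cong: restrict_cong)
qed

lemma L_comp:
  assumes "A \<in> L 0 k l" "B \<in> L 0 j k"
  shows "(\<lambda>u\<in>H_inf Sig H j. A (B u)) \<in> L 0 j l"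
  using L_compose[of 0 0 A k l B j] assms by (simp add: compose_def)

lemma L_in: "\<lbrakk>A \<in> L 0 j k; u \<in> H_inf Sig H j\<rbrakk> \<Longrightarrow> A u \<in> H_inf Sig H k"
  using linear_ops_in[of A] L0_linear by blast

lemma L_linear: "A \<in> L 0 j k \<Longrightarrow> A \<in> linear_ops scl (H_inf Sig H j) (H_inf Sig H k)"
  using L0_linear by blast

end

(* proj1_along: the projection onto V_1 is the one belonging to H_1^s = V_1 (+) im A_0^s, that is,
   it vanishes on im A_0 (for its extensions this amounts to ker = im A_0^s). This follows from the
   conclusion: A_0 - \<pi>_1 A_0 = A_0 A_1 A_0 = A_0 (1 - \<pi>_0) = A_0. *)
theorem proposition5p4:
  fixes scl :: "'k::real_normed_field \<Rightarrow> 'a::ab_group_add \<Rightarrow> 'a"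
    and Sig :: "(real^'n) set"
    and H :: "2 \<Rightarrow> real^'n \<Rightarrow> 'a normed_carrier"
    and L :: "ereal \<Rightarrow> 2 \<Rightarrow> 2 \<Rightarrow> ('a \<Rightarrow> 'a) set"
    and A\<^sub>0 \<pi>\<^sub>0 \<pi>\<^sub>1 :: "'a \<Rightarrow> 'a"
    and V\<^sub>0 V\<^sub>1 :: "'a set"
  assumes setting: "operator_classes scl Sig H L"
    and ell: "elliptic Sig H L A\<^sub>0"
    and V0: "finite_dim_subspace scl V\<^sub>0" "V\<^sub>0 \<subseteq> H_inf Sig H 0"
    and V1: "finite_dim_subspace scl V\<^sub>1" "V\<^sub>1 \<subseteq> H_inf Sig H 1"
    and kernel: "\<And>s. s \<in> Sig \<Longrightarrow> {u \<in> pts (H 0 s). ext_op scl Sig H 0 1 s A\<^sub>0 u = 0} = V\<^sub>0"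
    and complement: "\<And>s. s \<in> Sig \<Longrightarrow>
           is_direct_sum (pts (H 1 s)) V\<^sub>1 (ext_op scl Sig H 0 1 s A\<^sub>0 ` pts (H 0 s))"
    and proj0: "regularizing_projection Sig H L 0 V\<^sub>0 \<pi>\<^sub>0"
    and proj1: "regularizing_projection Sig H L 1 V\<^sub>1 \<pi>\<^sub>1"
    and proj1_along: "\<And>u. u \<in> H_inf Sig H 0 \<Longrightarrow> \<pi>\<^sub>1 (A\<^sub>0 u) = 0"
    and triple: "\<And>s A B C. \<lbrakk>s \<in> Sig; A \<in> L (-\<infinity>) 0 0;
                   B \<in> bounded_ops scl (H 1 s) (H 0 s); C \<in> L (-\<infinity>) 1 1\<rbrakk> \<Longrightarrow>
           (\<lambda>v\<in>H_inf Sig H 1. ext_op scl Sig H 0 0 s A (B (C v))) \<in> L (-\<infinity>) 1 0"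
  shows "\<exists>A\<^sub>1. parametrix Sig H L A\<^sub>0 A\<^sub>1 \<and>
           compose (H_inf Sig H 0) A\<^sub>1 A\<^sub>0 = (\<lambda>u\<in>H_inf Sig H 0. u - \<pi>\<^sub>0 u) \<and>
           compose (H_inf Sig H 1) A\<^sub>0 A\<^sub>1 = (\<lambda>v\<in>H_inf Sig H 1. v - \<pi>\<^sub>1 v)"
proof -
  interpret operator_classes scl Sig H L by (rule setting)
  obtain s where s: "s \<in> Sig" using Sig_nonempty by blast
  let ?D0 = "H_inf Sig H 0" and ?D1 = "H_inf Sig H 1"
  let ?X = "H 0 s" and ?Y = "H 1 s"
  note X = banach[OF s, of 0] and Y = banach[OF s, of 1]
  note D0 = subsetD[OF H_inf_subset[OF s, of 0]] and D1 = subsetD[OF H_inf_subset[OF s, of 1]]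
  have A: "A\<^sub>0 \<in> L 0 0 1" using ell by (simp add: elliptic_def)
  obtain B where "parametrix Sig H L A\<^sub>0 B" using ell by (auto simp: elliptic_def)
  define R0 where "R0 = (\<lambda>u\<in>?D0. u - B (A\<^sub>0 u))"
  define R1 where "R1 = (\<lambda>v\<in>?D1. v - A\<^sub>0 (B v))"
  have B: "B \<in> L 0 1 0" and R0inf: "R0 \<in> L (-\<infinity>) 0 0" and R1inf: "R1 \<in> L (-\<infinity>) 1 1"
    using \<open>parametrix Sig H L A\<^sub>0 B\<close> by (auto simp: parametrix_def R0_def R1_def)
  have R0: "R0 \<in> L 0 0 0" and R1: "R1 \<in> L 0 1 1"
    using R0inf R1inf Linf_subset by blast+
  have p0inf: "\<pi>\<^sub>0 \<in> L (-\<infinity>) 0 0" and p0_idem: "\<And>u. u \<in> ?D0 \<Longrightarrow> \<pi>\<^sub>0 (\<pi>\<^sub>0 u) = \<pi>\<^sub>0 u"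
    and p0_im: "\<pi>\<^sub>0 ` ?D0 = V\<^sub>0"
    using proj0 by (auto simp: regularizing_projection_def)
  have p1inf: "\<pi>\<^sub>1 \<in> L (-\<infinity>) 1 1" and p1_idem: "\<And>u. u \<in> ?D1 \<Longrightarrow> \<pi>\<^sub>1 (\<pi>\<^sub>1 u) = \<pi>\<^sub>1 u"
    and p1_im: "\<pi>\<^sub>1 ` ?D1 = V\<^sub>1"
    using proj1 by (auto simp: regularizing_projection_def)
  have p0: "\<pi>\<^sub>0 \<in> L 0 0 0" and p1: "\<pi>\<^sub>1 \<in> L 0 1 1"
    using p0inf p1inf Linf_subset by blast+
  define T where "T = ext_op scl Sig H 0 1 s A\<^sub>0"
  define S where "S = ext_op scl Sig H 1 0 s B"
  define K where "K = ext_op scl Sig H 0 0 s R0"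
  define P where "P = ext_op scl Sig H 0 0 s \<pi>\<^sub>0"
  define Q where "Q = ext_op scl Sig H 1 1 s \<pi>\<^sub>1"
  note T = ext_bounded[OF A s, folded T_def] ext_agrees[OF A s, folded T_def]
  note S = ext_bounded[OF B s, folded S_def] ext_agrees[OF B s, folded S_def]
  note K = ext_bounded[OF R0 s, folded K_def] ext_agrees[OF R0 s, folded K_def]
  note P = ext_bounded[OF p0 s, folded P_def] ext_agrees[OF p0 s, folded P_def]
  note Q = ext_bounded[OF p1 s, folded Q_def] ext_agrees[OF p1 s, folded Q_def]
  have K_reg: "K x \<in> ?D0" if "x \<in> pts ?X" for x
    using Linf_regularizing[OF R0inf s] that by (auto simp: K_def)
  have P_reg: "P x \<in> ?D0" if "x \<in> pts ?X" for x
    using Linf_regularizing[OF p0inf s] that by (auto simp: P_def)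
  have K_compact: "compact_op ?X ?X K"
    using compact[OF s K(1)] K_reg by blast
  \<comment> \<open>The identity \<open>1 = B A\<^sub>0 + R0\<close> and the algebra of the projections pass from \<^const>\<open>H_inf\<close>
      to the extensions by density.\<close>
  have STK: "x = S (T x) + K x" if x: "x \<in> pts ?X" for x
  proof -
    let ?I = "\<lambda>x\<in>pts ?X. x" and ?ST = "compose (pts ?X) S T"
    have "(\<lambda>x\<in>pts ?X. ?I x - ?ST x) x = K x"
      by (rule ext_eq_on_H_inf[OF s difference_bounded[OF X X identity_bounded[OF X]
              compose_bounded[OF X Y S(1) T(1)]] K(1) _ x])
        (simp add: D0 K(2) T(2) S(2) L_in[OF A] compose_def R0_def)
    then show ?thesis using x by (simp add: compose_def algebra_simps)
  qed
  have ker: "x \<in> V\<^sub>0 \<longleftrightarrow> x \<in> pts ?X \<and> T x = 0" for x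
    using kernel[OF s] by (auto simp: T_def)
  have P_idem: "P (P x) = P x" if x: "x \<in> pts ?X" for x
  proof -
    have "compose (pts ?X) P P x = P x"
      by (rule ext_eq_on_H_inf[OF s compose_bounded[OF X X P(1) P(1)] P(1) _ x])
        (simp add: D0 P(2) L_in[OF p0] compose_def p0_idem)
    then show ?thesis using x by (simp add: compose_def)
  qed
  \<comment> \<open>\<open>P\<close> is regularizing, so \<open>P x = P (P x)\<close> is a value of \<open>\<pi>\<^sub>0\<close> itself and lies in \<open>V\<^sub>0\<close>.\<close>
  have P_ker: "T (P x) = 0" if x: "x \<in> pts ?X" for x
  proof -
    have "P x = \<pi>\<^sub>0 (P x)" using P_idem[OF x] P(2)[OF P_reg[OF x]] by simp
    then have "P x \<in> V\<^sub>0" using P_reg[OF x] p0_im by blast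
    then show ?thesis using ker by blast
  qed
  have P_id: "P x = x" if "x \<in> pts ?X" "T x = 0" for x
  proof -
    have "x \<in> \<pi>\<^sub>0 ` ?D0" using that ker p0_im by blast
    then show ?thesis using P(2) p0_idem L_in[OF p0] by auto
  qed
  have Q_range: "Q (T x) = 0" if x: "x \<in> pts ?X" for x
  proof -
    let ?QT = "compose (pts ?X) Q T"
    have QT: "?QT \<in> bounded_ops scl ?X ?Y" by (rule compose_bounded[OF X Y Q(1) T(1)])
    \<comment> \<open>The right-hand side is the zero operator, written so as to be visibly bounded.\<close>
    have "?QT x = (\<lambda>x\<in>pts ?X. ?QT x - ?QT x) x"
      by (rule ext_eq_on_H_inf[OF s QT difference_bounded[OF X Y QT QT] _ x])
        (simp add: D0 T(2) Q(2) L_in[OF A] compose_def proj1_along)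
    then show ?thesis using x by (simp add: compose_def)
  qed
  have Q_compl: "y - Q y \<in> T ` pts ?X" if y: "y \<in> pts ?Y" for y
  proof -
    obtain v x where v: "v \<in> V\<^sub>1" and x: "x \<in> pts ?X" and y_eq: "y = v + T x"
      using complement[OF s] y by (auto simp: is_direct_sum_def T_def)
    have "v \<in> ?D1" using v V1(2) by blast
    moreover have "\<pi>\<^sub>1 v = v" using v p1_im p1_idem by auto
    ultimately have "Q y = v"
      using x by (simp add: y_eq bounded_ops_add[OF Q(1) D1 bounded_ops_in[OF T(1)]] Q(2) Q_range)
    then show ?thesis using x y_eq by auto
  qed
  have "\<exists>G\<in>bounded_ops scl ?Y ?X.
      (\<forall>y\<in>pts ?Y. T (G y) = y - Q y) \<and> (\<forall>x\<in>pts ?X. G (T x) = x - P x)"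
    by (rule bounded_inverse_modulo_projections[OF X Y T(1) S(1) K(1) K_compact _ P(1) _ _ Q(1)])
      (fact STK P_ker P_id Q_range Q_compl)+
  then obtain G where G: "G \<in> bounded_ops scl ?Y ?X"
    and TG: "\<And>y. y \<in> pts ?Y \<Longrightarrow> T (G y) = y - Q y" and GT: "\<And>x. x \<in> pts ?X \<Longrightarrow> G (T x) = x - P x"
    by blast
  define W where "W = (\<lambda>v\<in>?D1. K (G (R1 v)))"
  have W: "W \<in> L 0 1 0"
    using triple[OF s R0inf G R1inf] Linf_subset by (auto simp: W_def K_def)
  \<comment> \<open>\<open>x = B (A\<^sub>0 x) + R0 x\<close> is taken at \<open>x = G v\<close>, and within the term \<open>R0 (G v)\<close> the argument
      is rewritten by \<open>G = G R1 + (1 - \<pi>\<^sub>0) B\<close>.\<close>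
  have G_formula: "G v = (B v - B (\<pi>\<^sub>1 v)) + ((R0 (B v) - R0 (\<pi>\<^sub>0 (B v))) + W v)"
    if v: "v \<in> ?D1" for v
  proof -
    note Bv = L_in[OF B v] and p1v = L_in[OF p1 v] and R1v = L_in[OF R1 v]
    have "S (T (G v)) = B v - B (\<pi>\<^sub>1 v)"
      using TG[OF D1[OF v]] Q(2)[OF v] S(2)[OF subspace_diff[OF H_inf_subspace v p1v]]
        linear_ops_diff[OF L_linear[OF B] H_inf_subspace v p1v] by simp
    moreover have "G v = G (R1 v) + (B v - \<pi>\<^sub>0 (B v))"
    proof -
      have "v = R1 v + A\<^sub>0 (B v)" using v by (simp add: R1_def)
      then have "G v = G (R1 v) + G (A\<^sub>0 (B v))"
        using bounded_ops_add[OF G D1[OF R1v] D1[OF L_in[OF A Bv]]] by metis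
      then show ?thesis using GT[OF D0[OF Bv]] T(2)[OF Bv] P(2)[OF Bv] by simp
    qed
    moreover have "K (G (R1 v) + (B v - \<pi>\<^sub>0 (B v))) = W v + (R0 (B v) - R0 (\<pi>\<^sub>0 (B v)))"
      using v Bv R1v L_in[OF p0 Bv] subspace_diff[OF H_inf_subspace Bv L_in[OF p0 Bv]]
      by (simp add: W_def bounded_ops_add[OF K(1)] D0 D1 bounded_ops_in[OF G] K(2)
          linear_ops_diff[OF L_linear[OF R0] H_inf_subspace])
    ultimately show ?thesis
      using STK[OF bounded_ops_in[OF G D1[OF v]]] by (metis add.commute)
  qed
  define A1 where "A1 = restrict G ?D1"
  have A1: "A1 \<in> L 0 1 0"
  proof -
    note BBp1 = L_diff[OF B L_comp[OF B p1]]
    note R0B = L_diff[OF L_comp[OF R0 B] L_comp[OF R0 L_comp[OF p0 B]]]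
    from L_add[OF BBp1 L_add[OF R0B W]] show ?thesis
      by (simp add: A1_def G_formula cong: restrict_cong)
  qed
  have left: "A1 (A\<^sub>0 u) = u - \<pi>\<^sub>0 u" if u: "u \<in> ?D0" for u
    using GT[OF D0[OF u]] T(2)[OF u] P(2)[OF u] L_in[OF A u] by (simp add: A1_def)
  have right: "A\<^sub>0 (A1 v) = v - \<pi>\<^sub>1 v" if v: "v \<in> ?D1" for v
    using TG[OF D1[OF v]] T(2)[OF L_in[OF A1 v]] Q(2)[OF v] v by (simp add: A1_def)
  have "(\<lambda>u\<in>?D0. u - A1 (A\<^sub>0 u)) = \<pi>\<^sub>0" "(\<lambda>v\<in>?D1. v - A\<^sub>0 (A1 v)) = \<pi>\<^sub>1"
    using linear_ops_extensional[OF L_linear[OF p0]] linear_ops_extensional[OF L_linear[OF p1]]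
    by (simp_all add: left right extensional_restrict cong: restrict_cong)
  then have "parametrix Sig H L A\<^sub>0 A1"
    using A1 p0inf p1inf by (simp add: parametrix_def)
  moreover have "compose ?D0 A1 A\<^sub>0 = (\<lambda>u\<in>?D0. u - \<pi>\<^sub>0 u)" "compose ?D1 A\<^sub>0 A1 = (\<lambda>v\<in>?D1. v - \<pi>\<^sub>1 v)"
    by (simp_all add: compose_def left right cong: restrict_cong)
  ultimately show ?thesis by blast
qed

end
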